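(* \[ \left\{\frac{189+15\sqrt{5}}{961},\ \frac{6}{25},\ \frac{8}{27},\ \frac{1}{3},\ \frac{7}{18},\ \frac{32}{81},\ \frac{13\sqrt{13}-35}{27}\right\}\subseteq \Pi_{\mathrm{fin}}^{(3)}. \] That is, each of these numbers is the Turán density of some finite family of $3$-graphs.
   Context: A $3$-graph is a pair $(V,E)$ where $V$ is a finite vertex set and $E$ is a set of $3$-element subsets of $V$ (edges). $e(G)$ is the number of edges of $G$. For a family $\mathcal{F}$ of $3$-graphs, a $3$-graph is $\mathcal{F}$-free if it contains no (not necessarily induced) subgraph isomorphic to a member of $\mathcal{F}$. Define $\mathrm{ex}(n,\mathcal{F})=\max\{e(G): G \text{ is } \mathcal{F}\text{-free}, |V(G)|=n\}$ and the Turán density $\pi(\mathcal{F})=\lim_{n\to\infty}\mathrm{ex}(n,\mathcal{F})/\binom{n}{3}$ (the limit always exists). $\Pi^{(3)}_{\mathrm{fin}}=\{\pi(\mathcal{F}):\mathcal{F}\text{ is a finite family of }3\text{-graphs}\}$. *)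

theory Defs
  imports Complex_Main
begin

type_synonym 'a hgraph = "'a set \<times> 'a set set"

abbreviation verts :: "'a hgraph \<Rightarrow> 'a set" where
  "verts G \<equiv> fst G"

abbreviation edges :: "'a hgraph \<Rightarrow> 'a set set" where
  "edges G \<equiv> snd G"

definition three_graph :: "'a hgraph \<Rightarrow> bool" where
  "three_graph G \<longleftrightarrow> finite (verts G) \<and> (\<forall>e\<in>edges G. e \<subseteq> verts G \<and> card e = 3)"

definition subgraph :: "'a hgraph \<Rightarrow> 'a hgraph \<Rightarrow> bool" where
  "subgraph H G \<longleftrightarrow> three_graph H \<and> verts H \<subseteq> verts G \<and> edges H \<subseteq> edges G"

definition isomorphic :: "'a hgraph \<Rightarrow> 'b hgraph \<Rightarrow> bool" where
  "isomorphic G H \<longleftrightarrow>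
     (\<exists>f. bij_betw f (verts G) (verts H) \<and> (\<lambda>e. f ` e) ` edges G = edges H)"

definition free_of :: "'b hgraph set \<Rightarrow> 'a hgraph \<Rightarrow> bool" where
  "free_of \<F> G \<longleftrightarrow> \<not> (\<exists>F\<in>\<F>. \<exists>H. subgraph H G \<and> isomorphic H F)"

(* Every finite 3-graph has a copy with vertices in nat, so nothing is lost by
   taking all vertex sets inside nat. The supremum is over a bounded set of naturals, hence
   a maximum unless no F-free 3-graph on n vertices exists (which needs a member of the
   family without edges); in that case it is 0. *)
definition ex :: "nat \<Rightarrow> nat hgraph set \<Rightarrow> nat" where
  "ex n \<F> = Sup {card (edges G) | G :: nat hgraph.
     three_graph G \<and> free_of \<F> G \<and> card (verts G) = n}"

definition turan_density :: "nat hgraph set \<Rightarrow> real" where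
  "turan_density \<F> = lim (\<lambda>n. real (ex n \<F>) / real (n choose 3))"

definition Pi_fin :: "real set" where
  "Pi_fin = {turan_density \<F> | \<F>. finite \<F> \<and> (\<forall>F\<in>\<F>. three_graph F)}"

end

theory Submission
  imports Defs "HOL-Library.FuncSet" "HOL-Library.Nat_Bijection"
begin

text \<open>
  The Lagrange polynomial of a 3-graph \<open>P\<close> is the sum, over its edges, of the products of the
  three vertex weights; let \<open>c\<close> be its maximum over nonnegative weights of total 1. The key point
  is that \<open>6 * c\<close> is always the Turan density of a finite family
  (\<open>lagrangian_density_in_Pi_fin\<close>): take all 3-graphs on at most \<open>M\<close> vertices that have no
  homomorphism to \<open>P\<close>, with \<open>M\<close> large in terms of \<open>P\<close>. Blow-ups of \<open>P\<close>, with parts proportional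
  to optimal weights, avoid this family and have density tending to \<open>6 * c\<close>.

  For the upper bound, consider the Lagrange polynomial of a 3-graph \<open>G\<close> that avoids the family.
  If two vertices lie in no common edge, the polynomial is affine along the line that moves
  weight between them, so all their weight can go to the better one and the other can be deleted
  (\<open>lagrange_poly_shift_weight\<close>). In the end every pair of vertices is covered by an edge.
  A homomorphism to \<open>P\<close> is injective on edges, hence on any set whose pairs are covered. If \<open>G\<close> had
  more vertices than \<open>P\<close>, then one vertex more than \<open>P\<close> has, together with one edge for each pair
  of them, would form a small subgraph without a homomorphism to \<open>P\<close>
  (\<open>pair_covered_card_le\<close>). So \<open>G\<close> is itself small, it embeds into \<open>P\<close>, and its
  polynomial is bounded by that of \<open>P\<close>. Constant weights turn this into a bound on the number of
  edges.

  It remains to find, for each of the seven numbers, a 3-graph on at most six vertices whose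
  Lagrange polynomial has the required maximum. In each case inequalities between means reduce
  the polynomial to one in at most three variables. They are sharp at the optimal weights, where
  the remaining difference to the bound therefore has a double zero; the squares in the explicit
  identities account for it.
\<close>

section \<open>Homomorphisms and finite families of obstructions\<close>

text \<open>
  The witness is a homomorphism to \<open>P\<close>. Vertices outside all edges may be mapped anywhere, even
  outside \<open>P\<close>, which makes the notion depend on the edges alone.
\<close>
definition colourable :: "'b hgraph \<Rightarrow> 'a hgraph \<Rightarrow> bool" where
  "colourable P G \<longleftrightarrow> (\<exists>\<phi>. \<forall>e\<in>edges G. \<phi> ` e \<in> edges P)"

definition obstructions :: "'b hgraph \<Rightarrow> nat \<Rightarrow> nat hgraph set" where
  "obstructions P M = {F. three_graph F \<and> verts F \<subseteq> {..<M} \<and> \<not> colourable P F}"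

lemma three_graph_finite_edges: "three_graph G \<Longrightarrow> finite (edges G)"
  unfolding three_graph_def by (rule finite_subset[of _ "Pow (verts G)"]) auto

lemma three_graph_edge:
  assumes "three_graph G" "e \<in> edges G"
  shows "e \<subseteq> verts G" "card e = 3" "finite e"
  using assms unfolding three_graph_def by (auto intro: finite_subset)

lemma finite_obstructions: "finite (obstructions P M)"
proof (rule finite_subset)
  show "obstructions P M \<subseteq> Pow {..<M} \<times> Pow (Pow {..<M})"
  proof
    fix F assume "F \<in> obstructions P M"
    then have F: "three_graph F" "verts F \<subseteq> {..<M}" by (simp_all add: obstructions_def)
    then have "edges F \<subseteq> Pow {..<M}" using three_graph_edge(1)[OF F(1)] by blast
    then show "F \<in> Pow {..<M} \<times> Pow (Pow {..<M})" using F(2) by (simp add: mem_Times_iff)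
  qed
qed simp

lemma colourable_isomorphic:
  assumes "three_graph H" "isomorphic H F" "colourable P H"
  shows "colourable P F"
proof -
  obtain f where f: "bij_betw f (verts H) (verts F)" "(\<lambda>e. f ` e) ` edges H = edges F"
    using assms(2) unfolding isomorphic_def by blast
  obtain \<phi> where \<phi>: "\<forall>e\<in>edges H. \<phi> ` e \<in> edges P"
    using assms(3) unfolding colourable_def by blast
  let ?g = "inv_into (verts H) f"
  have "(\<phi> \<circ> ?g) ` e' \<in> edges P" if "e' \<in> edges F" for e'
  proof -
    have "e' \<in> (\<lambda>e. f ` e) ` edges H" using that f(2) by simp
    then obtain e where e: "e \<in> edges H" "e' = f ` e" by (elim imageE)
    have "e \<subseteq> verts H" using three_graph_edge[OF assms(1) e(1)] by simp
    then have "?g ` e' = e"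
      using f(1) e(2) by (simp add: bij_betw_def inv_into_image_cancel)
    then show ?thesis using \<phi> e(1) by (metis image_comp)
  qed
  then show ?thesis unfolding colourable_def by blast
qed

text \<open>
  Homomorphisms to \<open>P\<close> restrict to subgraphs and transfer along isomorphisms, so a 3-graph that
  has one contains no member of the family.
\<close>
lemma colourable_free:
  assumes "colourable P G"
  shows "free_of (obstructions P M) G"
  unfolding free_of_def
proof clarify
  fix F H assume F: "F \<in> obstructions P M" and H: "subgraph H G" "isomorphic H F"
  have "colourable P H"
    using assms H(1) unfolding colourable_def subgraph_def by blast
  then have "colourable P F"
    using colourable_isomorphic H unfolding subgraph_def by blast
  then show False using F by (simp add: obstructions_def)
qed

text \<open>
  The partial converse: only members of the family with at most \<open>M\<close> vertices are at hand, so
  avoiding the family yields homomorphisms locally, on small subgraphs.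
\<close>
lemma free_small_colourable:
  assumes "free_of (obstructions P M) G" "subgraph H G" "card (verts H) \<le> M"
  shows "colourable P H"
proof (rule ccontr)
  assume nc: "\<not> colourable P H"
  have tH: "three_graph H" using assms(2) by (simp add: subgraph_def)
  then have "finite (verts H)" by (simp add: three_graph_def)
  then obtain f where f: "bij_betw f (verts H) {0..<card (verts H)}"
    using ex_bij_betw_finite_nat by blast
  define F where "F = (f ` verts H, (\<lambda>e. f ` e) ` edges H)"
  have iso: "isomorphic H F"
    using f unfolding isomorphic_def F_def by (auto intro!: exI[of _ f] simp: bij_betw_def)
  have "card (f ` e) = 3" if "e \<in> edges H" for e
    using three_graph_edge[OF tH that] f
    by (metis bij_betw_def card_image inj_on_subset)
  then have "three_graph F"
    using tH unfolding three_graph_def F_def by (auto simp: image_mono)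
  moreover have "verts F \<subseteq> {..<M}"
    using f assms(3) unfolding F_def bij_betw_def by auto
  moreover have "\<not> colourable P F"
  proof
    assume "colourable P F"
    then obtain \<phi> where "\<forall>e\<in>edges F. \<phi> ` e \<in> edges P" unfolding colourable_def by blast
    then have "\<forall>e\<in>edges H. (\<phi> \<circ> f) ` e \<in> edges P" by (simp add: F_def image_comp)
    then show False using nc unfolding colourable_def by blast
  qed
  ultimately show False
    using assms(1,2) iso unfolding free_of_def obstructions_def by blast
qed

lemma free_of_subgraph:
  assumes "free_of \<F> G" "verts H \<subseteq> verts G" "edges H \<subseteq> edges G"
  shows "free_of \<F> H"
  using assms unfolding free_of_def subgraph_def by blast

lemma colouring_inj_on_edge:
  assumes "three_graph P" "three_graph G" "e \<in> edges G" "\<phi> ` e \<in> edges P"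
  shows "inj_on \<phi> e"
  using three_graph_edge[OF assms(1,4)] three_graph_edge[OF assms(2,3)]
  by (simp add: eq_card_imp_inj_on)

section \<open>Symmetrization\<close>

definition pair_covered :: "'a hgraph \<Rightarrow> bool" where
  "pair_covered G \<longleftrightarrow> (\<forall>u\<in>verts G. \<forall>v\<in>verts G. u \<noteq> v \<longrightarrow> (\<exists>e\<in>edges G. u \<in> e \<and> v \<in> e))"

definition delete_vertex :: "'a hgraph \<Rightarrow> 'a \<Rightarrow> 'a hgraph" where
  "delete_vertex G v = (verts G - {v}, {e\<in>edges G. v \<notin> e})"

text \<open>
  The role of \<open>M\<close>: with \<open>m\<close> the number of vertices of \<open>P\<close>, choose \<open>m + 1\<close> vertices of \<open>G\<close> and an
  edge through each ordered pair of them. These edges cover at most \<open>3 * (m + 1)\<^sup>2\<close> vertices, so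
  they have a homomorphism to \<open>P\<close>. It separates the chosen vertices, because each pair lies in an
  edge and an edge is mapped to three vertices; but \<open>P\<close> has only \<open>m\<close> vertices.
\<close>
lemma pair_covered_card_le:
  fixes P :: "'b hgraph"
  assumes P: "three_graph P" "verts P \<noteq> {}" and G: "three_graph G" "pair_covered G"
    and free: "free_of (obstructions P M) G"
    and M: "M \<ge> 3 * (card (verts P) + 1)\<^sup>2"
  shows "card (verts G) \<le> card (verts P)"
proof (rule ccontr)
  assume "\<not> card (verts G) \<le> card (verts P)"
  then have "card (verts P) + 1 \<le> card (verts G)" by simp
  then obtain S where S: "S \<subseteq> verts G" "card S = card (verts P) + 1" "finite S"
    by (meson obtain_subset_with_card_n)
  have "\<exists>e\<in>edges G. u \<in> e \<and> v \<in> e" if "u \<in> S" "v \<in> S" "u \<noteq> v" for u v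
    using G(2) S(1) that unfolding pair_covered_def by blast
  then obtain c where c: "\<And>u v. u \<in> S \<Longrightarrow> v \<in> S \<Longrightarrow> u \<noteq> v \<Longrightarrow>
      c u v \<in> edges G \<and> u \<in> c u v \<and> v \<in> c u v"
    by metis
  define E where "E = (\<lambda>(u, v). c u v) ` {(u, v) \<in> S \<times> S. u \<noteq> v}"
  have fin: "finite {(u, v) \<in> S \<times> S. u \<noteq> v}"
    by (rule finite_subset[of _ "S \<times> S"]) (use S(3) in auto)
  have EG: "E \<subseteq> edges G" unfolding E_def using c by auto
  have "card E \<le> card (S \<times> S)"
    unfolding E_def
    by (rule order_trans[OF card_image_le[OF fin] card_mono]) (use S(3) in auto)
  then have cE: "card E \<le> (card (verts P) + 1)\<^sup>2"
    using S(2) by (simp add: card_cartesian_product power2_eq_square)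
  have finE: "finite E" unfolding E_def using fin by simp
  have "card (\<Union>E) \<le> (\<Sum>e\<in>E. card e)" by (simp add: card_Union_le_sum_card)
  also have "\<dots> = (\<Sum>e\<in>E. 3)"
    by (rule sum.cong) (use EG three_graph_edge[OF G(1)] in auto)
  also have "\<dots> \<le> M" using cE M by simp
  finally have cU: "card (\<Union>E) \<le> M" .
  have sub: "subgraph (\<Union>E, E) G"
    using EG three_graph_edge[OF G(1)] finE
    by (simp add: subgraph_def three_graph_def subset_iff) blast
  then obtain \<phi> where \<phi>: "\<And>e. e \<in> E \<Longrightarrow> \<phi> ` e \<in> edges P"
    using free_small_colourable[OF free sub] cU unfolding colourable_def by auto
  have inE: "c u v \<in> E" if "u \<in> S" "v \<in> S" "u \<noteq> v" for u v
    unfolding E_def using that by force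
  have "inj_on \<phi> S"
  proof (rule inj_onI, rule ccontr)
    fix u v assume uv: "u \<in> S" "v \<in> S" "\<phi> u = \<phi> v" "u \<noteq> v"
    have "inj_on \<phi> (c u v)"
      using colouring_inj_on_edge[OF P(1) G(1)] \<phi>[OF inE] c uv by blast
    then show False using c[OF uv(1,2,4)] uv by (auto dest: inj_onD)
  qed
  moreover have "\<phi> ` S \<subseteq> verts P"
  proof
    fix i assume "i \<in> \<phi> ` S"
    then obtain u where u: "u \<in> S" "i = \<phi> u" by blast
    have "card (verts P) \<noteq> 0" using P by (simp add: three_graph_def)
    then have "card S \<noteq> 1" using S(2) by simp
    then have "S \<noteq> {u}" by auto
    then obtain v where v: "v \<in> S" "u \<noteq> v" using u by blast
    have "\<phi> ` c u v \<subseteq> verts P"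
      using three_graph_edge[OF P(1) \<phi>[OF inE[OF u(1) v]]] by simp
    then show "i \<in> verts P" using c[OF u(1) v] u(2) by blast
  qed
  ultimately have "card S \<le> card (verts P)"
    using P(1) by (metis card_inj_on_le three_graph_def)
  then show False using S(2) by simp
qed

definition lagrange_poly :: "'a hgraph \<Rightarrow> ('a \<Rightarrow> real) \<Rightarrow> real" where
  "lagrange_poly G x = (\<Sum>e\<in>edges G. \<Prod>v\<in>e. x v)"

lemma lagrange_poly_nonneg: "(\<And>v. x v \<ge> 0) \<Longrightarrow> lagrange_poly G x \<ge> 0"
  unfolding lagrange_poly_def by (intro sum_nonneg prod_nonneg) auto

text \<open>
  Transporting the weights along \<open>\<phi>\<close> turns the terms of the polynomial of \<open>G\<close> into distinct terms
  of the polynomial of \<open>P\<close>. The bound is in homogeneous form because isolated vertices of \<open>G\<close> may be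
  mapped outside \<open>P\<close>, which only decreases the total weight.
\<close>
lemma lagrange_poly_le_of_injective_colouring:
  fixes P :: "'b hgraph"
  assumes P: "three_graph P" and G: "three_graph G"
    and \<phi>: "inj_on \<phi> (verts G)" "\<And>e. e \<in> edges G \<Longrightarrow> \<phi> ` e \<in> edges P"
    and bound: "\<And>y. (\<And>i. y i \<ge> 0) \<Longrightarrow> lagrange_poly P y \<le> c * (\<Sum>i\<in>verts P. y i) ^ 3"
    and c: "c \<ge> 0" and x: "\<And>v. x v \<ge> 0"
  shows "lagrange_poly G x \<le> c * (\<Sum>v\<in>verts G. x v) ^ 3"
proof -
  let ?V = "verts G"
  define y where "y i = (if i \<in> \<phi> ` ?V then x (inv_into ?V \<phi> i) else 0)" for i
  have y0: "y i \<ge> 0" for i unfolding y_def using x by simp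
  have y\<phi>: "y (\<phi> v) = x v" if "v \<in> ?V" for v
    unfolding y_def using that \<phi>(1) by simp
  have inj: "inj_on (\<lambda>e. \<phi> ` e) (edges G)"
    using inj_on_image_Pow[OF \<phi>(1)] three_graph_edge(1)[OF G] by (meson PowI inj_on_subset subsetI)
  have "lagrange_poly G x = (\<Sum>e\<in>edges G. \<Prod>i\<in>\<phi> ` e. y i)"
    unfolding lagrange_poly_def
  proof (rule sum.cong[OF refl])
    fix e assume "e \<in> edges G"
    then have e: "e \<subseteq> ?V" using three_graph_edge[OF G] by simp
    then have "inj_on \<phi> e" using \<phi>(1) by (rule inj_on_subset[rotated])
    then have "(\<Prod>i\<in>\<phi> ` e. y i) = (\<Prod>v\<in>e. y (\<phi> v))" by (simp add: prod.reindex)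
    also have "\<dots> = (\<Prod>v\<in>e. x v)" by (rule prod.cong) (use e y\<phi> in auto)
    finally show "(\<Prod>v\<in>e. x v) = (\<Prod>i\<in>\<phi> ` e. y i)" by simp
  qed
  also have "\<dots> = (\<Sum>f\<in>(\<lambda>e. \<phi> ` e) ` edges G. \<Prod>i\<in>f. y i)"
    using inj by (simp add: sum.reindex)
  also have "\<dots> \<le> lagrange_poly P y"
    unfolding lagrange_poly_def
    by (rule sum_mono2) (use three_graph_finite_edges[OF P] \<phi>(2) y0 in \<open>auto intro: prod_nonneg\<close>)
  also have "\<dots> \<le> c * (\<Sum>i\<in>verts P. y i) ^ 3" using bound y0 by blast
  also have "\<dots> \<le> c * (\<Sum>v\<in>?V. x v) ^ 3"
  proof -
    have "(\<Sum>i\<in>verts P. y i) = (\<Sum>i\<in>verts P \<inter> \<phi> ` ?V. y i)"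
      by (rule sum.mono_neutral_right) (use P in \<open>auto simp: y_def three_graph_def\<close>)
    also have "\<dots> \<le> (\<Sum>i\<in>\<phi> ` ?V. y i)"
      by (rule sum_mono2) (use G y0 in \<open>auto simp: three_graph_def\<close>)
    also have "\<dots> = (\<Sum>v\<in>?V. x v)"
      using \<phi>(1) y\<phi> by (simp add: sum.reindex)
    finally show ?thesis
      using c y0 by (intro mult_left_mono power_mono sum_nonneg) auto
  qed
  finally show ?thesis .
qed

text \<open>
  No edge contains both \<open>u\<close> and \<open>v\<close>, so the polynomial has the form \<open>A + x u * B + x v * C\<close> with
  \<open>A\<close>, \<open>B\<close>, \<open>C\<close> independent of \<open>x u\<close> and \<open>x v\<close>. If \<open>C \<le> B\<close>, all the weight of \<open>v\<close> can go to \<open>u\<close>.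
\<close>
lemma lagrange_poly_shift_weight:
  assumes G: "three_graph G"
    and nc: "\<not> (\<exists>e\<in>edges G. u \<in> e \<and> v \<in> e)"
    and x: "\<And>w. x w \<ge> 0"
    and le: "(\<Sum>e | e \<in> edges G \<and> v \<in> e. \<Prod>w\<in>e - {v}. x w)
           \<le> (\<Sum>e | e \<in> edges G \<and> u \<in> e. \<Prod>w\<in>e - {u}. x w)"
  shows "lagrange_poly G x \<le> lagrange_poly (delete_vertex G v) (x(u := x u + x v))"
proof -
  let ?E = "edges G"
  let ?N = "{e\<in>?E. u \<notin> e \<and> v \<notin> e}" and ?U = "{e\<in>?E. u \<in> e}" and ?W = "{e\<in>?E. v \<in> e}"
  let ?y = "x(u := x u + x v)"
  note fin = three_graph_finite_edges[OF G]
  have pull: "(\<Prod>w\<in>e. z w) = z a * (\<Prod>w\<in>e - {a}. z w)"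
    if "e \<in> ?E" "a \<in> e" for e a and z :: "'a \<Rightarrow> real"
    using that three_graph_edge[OF G] by (simp add: prod.remove)
  have split: "?E = ?N \<union> ?U \<union> ?W" by auto
  have "lagrange_poly G x = (\<Sum>e\<in>?N. \<Prod>w\<in>e. x w) + (\<Sum>e\<in>?U. \<Prod>w\<in>e. x w) + (\<Sum>e\<in>?W. \<Prod>w\<in>e. x w)"
    unfolding lagrange_poly_def by (subst split, subst sum.union_disjoint; (subst sum.union_disjoint)?)
      (use fin nc in auto)
  also have "(\<Sum>e\<in>?U. \<Prod>w\<in>e. x w) = x u * (\<Sum>e\<in>?U. \<Prod>w\<in>e - {u}. x w)"
    unfolding sum_distrib_left by (rule sum.cong) (auto intro: pull)
  also have "(\<Sum>e\<in>?W. \<Prod>w\<in>e. x w) = x v * (\<Sum>e\<in>?W. \<Prod>w\<in>e - {v}. x w)"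
    unfolding sum_distrib_left by (rule sum.cong) (auto intro: pull)
  also have "x v * (\<Sum>e\<in>?W. \<Prod>w\<in>e - {v}. x w) \<le> x v * (\<Sum>e\<in>?U. \<Prod>w\<in>e - {u}. x w)"
    using le x by (intro mult_left_mono) auto
  finally have "lagrange_poly G x \<le> (\<Sum>e\<in>?N. \<Prod>w\<in>e. x w) + (x u + x v) * (\<Sum>e\<in>?U. \<Prod>w\<in>e - {u}. x w)"
    by (simp add: algebra_simps)
  also have "(\<Sum>e\<in>?N. \<Prod>w\<in>e. x w) = (\<Sum>e\<in>?N. \<Prod>w\<in>e. ?y w)"
    by (intro sum.cong prod.cong refl) auto
  also have "(x u + x v) * (\<Sum>e\<in>?U. \<Prod>w\<in>e - {u}. x w) = (\<Sum>e\<in>?U. \<Prod>w\<in>e. ?y w)"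
    unfolding sum_distrib_left
  proof (rule sum.cong[OF refl])
    fix e assume "e \<in> ?U"
    then have "(\<Prod>w\<in>e. ?y w) = ?y u * (\<Prod>w\<in>e - {u}. ?y w)" using pull by blast
    also have "(\<Prod>w\<in>e - {u}. ?y w) = (\<Prod>w\<in>e - {u}. x w)" by (rule prod.cong) auto
    finally show "(x u + x v) * (\<Prod>w\<in>e - {u}. x w) = (\<Prod>w\<in>e. ?y w)" by simp
  qed
  also have "(\<Sum>e\<in>?N. \<Prod>w\<in>e. ?y w) + (\<Sum>e\<in>?U. \<Prod>w\<in>e. ?y w) = (\<Sum>e\<in>?N \<union> ?U. \<Prod>w\<in>e. ?y w)"
    by (rule sum.union_disjoint[symmetric]) (use fin in auto)
  also have "?N \<union> ?U = edges (delete_vertex G v)"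
    unfolding delete_vertex_def using nc by auto
  finally show ?thesis unfolding lagrange_poly_def .
qed

text \<open>
  Induction on the number of vertices: an uncovered pair allows one of its vertices to be deleted,
  and a pair-covered 3-graph is small enough to be embedded into \<open>P\<close>.
\<close>
lemma lagrange_poly_free_le:
  fixes P :: "'b hgraph"
  assumes P: "three_graph P" "verts P \<noteq> {}"
    and bound: "\<And>y. (\<And>i. y i \<ge> 0) \<Longrightarrow> lagrange_poly P y \<le> c * (\<Sum>i\<in>verts P. y i) ^ 3"
    and c: "c \<ge> 0" and M: "M \<ge> 3 * (card (verts P) + 1)\<^sup>2"
    and "three_graph G" "free_of (obstructions P M) G" "\<And>v. x v \<ge> 0"
  shows "lagrange_poly G x \<le> c * (\<Sum>v\<in>verts G. x v) ^ 3"
  using assms(6-8)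
proof (induction "card (verts G)" arbitrary: G x rule: less_induct)
  case less
  note G = \<open>three_graph G\<close> and free = \<open>free_of (obstructions P M) G\<close>
  have finV: "finite (verts G)" using G by (simp add: three_graph_def)
  show ?case
  proof (cases "pair_covered G")
    case True
    have "card (verts G) \<le> card (verts P)"
      by (rule pair_covered_card_le[OF P G True free M])
    also have "\<dots> \<le> (card (verts P) + 1)\<^sup>2" by (simp add: power2_eq_square)
    also have "\<dots> \<le> M" using M by linarith
    finally have "colourable P G"
      using free_small_colourable[OF free] G by (simp add: subgraph_def)
    then obtain \<phi> where \<phi>: "\<And>e. e \<in> edges G \<Longrightarrow> \<phi> ` e \<in> edges P"
      unfolding colourable_def by blast
    have "inj_on \<phi> (verts G)"
    proof (rule inj_onI, rule ccontr)
      fix u v assume uv: "u \<in> verts G" "v \<in> verts G" "\<phi> u = \<phi> v" "u \<noteq> v"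
      then obtain e where e: "e \<in> edges G" "u \<in> e" "v \<in> e"
        using True unfolding pair_covered_def by blast
      then have "inj_on \<phi> e" using colouring_inj_on_edge[OF P(1) G] \<phi> by blast
      then show False using e uv by (auto dest: inj_onD)
    qed
    then show ?thesis
      using lagrange_poly_le_of_injective_colouring[OF P(1) G _ \<phi> bound c] less.prems(3) by blast
  next
    case False
    have step: ?thesis if uv: "u \<in> verts G" "v \<in> verts G" "u \<noteq> v"
      and nc: "\<not> (\<exists>e\<in>edges G. u \<in> e \<and> v \<in> e)"
      and le: "(\<Sum>e | e \<in> edges G \<and> v \<in> e. \<Prod>w\<in>e - {v}. x w)
           \<le> (\<Sum>e | e \<in> edges G \<and> u \<in> e. \<Prod>w\<in>e - {u}. x w)" for u v
    proof -
      let ?H = "delete_vertex G v" and ?y = "x(u := x u + x v)"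
      have "lagrange_poly G x \<le> lagrange_poly ?H ?y"
        by (rule lagrange_poly_shift_weight[OF G nc less.prems(3) le])
      also have "\<dots> \<le> c * (\<Sum>w\<in>verts ?H. ?y w) ^ 3"
      proof (rule less.hyps)
        show "card (verts ?H) < card (verts G)"
          using card_Diff1_less[OF finV uv(2)] by (simp add: delete_vertex_def)
        show "three_graph ?H"
          using G unfolding delete_vertex_def three_graph_def by auto
        show "free_of (obstructions P M) ?H"
          by (rule free_of_subgraph[OF free]) (auto simp: delete_vertex_def)
        show "?y w \<ge> 0" for w using less.prems(3) by simp
      qed
      also have "(\<Sum>w\<in>verts ?H. ?y w) = (\<Sum>w\<in>verts G. x w)"
      proof -
        have "(\<Sum>w\<in>verts ?H. ?y w) = ?y u + (\<Sum>w\<in>verts G - {v} - {u}. ?y w)"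
          using finV uv by (simp add: delete_vertex_def sum.remove)
        also have "(\<Sum>w\<in>verts G - {v} - {u}. ?y w) = (\<Sum>w\<in>verts G - {v} - {u}. x w)"
          by (rule sum.cong) auto
        also have "?y u + \<dots> = x v + (x u + (\<Sum>w\<in>verts G - {v} - {u}. x w))" by simp
        also have "\<dots> = x v + (\<Sum>w\<in>verts G - {v}. x w)"
          using finV uv by (simp add: sum.remove[of "verts G - {v}" u])
        also have "\<dots> = (\<Sum>w\<in>verts G. x w)" by (rule sum.remove[OF finV uv(2), symmetric])
        finally show ?thesis .
      qed
      finally show ?thesis .
    qed
    obtain u v where uv: "u \<in> verts G" "v \<in> verts G" "u \<noteq> v"
      and nc: "\<not> (\<exists>e\<in>edges G. u \<in> e \<and> v \<in> e)"
      using False unfolding pair_covered_def by blast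
    then have nc': "\<not> (\<exists>e\<in>edges G. v \<in> e \<and> u \<in> e)" by blast
    show ?thesis
      by (rule linorder_le_cases; rule step[OF uv nc] step[OF uv(2,1) uv(3)[symmetric] nc'])
  qed
qed

section \<open>Extremal numbers and the limit density\<close>

lemma ex_le:
  fixes B :: real
  assumes "B \<ge> 0"
    and "\<And>G :: nat hgraph. three_graph G \<Longrightarrow> free_of \<F> G \<Longrightarrow> card (verts G) = n \<Longrightarrow> card (edges G) \<le> B"
  shows "real (ex n \<F>) \<le> B"
proof -
  let ?S = "{card (edges G) | G :: nat hgraph. three_graph G \<and> free_of \<F> G \<and> card (verts G) = n}"
  have "ex n \<F> \<le> nat \<lfloor>B\<rfloor>"
  proof (cases "?S = {}")
    case True
    then show ?thesis unfolding ex_def by (simp only: Sup_nat_empty)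
  next
    case False
    then show ?thesis unfolding ex_def
      by (rule cSup_least) (use assms(2) in \<open>auto simp: le_nat_floor\<close>)
  qed
  then show ?thesis using assms(1) by linarith
qed

lemma ex_ge:
  fixes G :: "nat hgraph"
  assumes "three_graph G" "free_of \<F> G"
  shows "card (edges G) \<le> ex (card (verts G)) \<F>"
  unfolding ex_def
proof (rule cSup_upper)
  show "card (edges G) \<in> {card (edges H) | H :: nat hgraph.
     three_graph H \<and> free_of \<F> H \<and> card (verts H) = card (verts G)}"
    using assms by blast
  show "bdd_above {card (edges H) | H :: nat hgraph.
     three_graph H \<and> free_of \<F> H \<and> card (verts H) = card (verts G)}"
  proof (rule bdd_aboveI, clarify)
    fix V :: "nat set" and E
    assume H: "three_graph (V, E)" "card (verts (V, E)) = card (verts G)"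
    have "card E \<le> card (Pow V)"
      by (rule card_mono) (use H(1) in \<open>auto simp: three_graph_def\<close>)
    then show "card (edges (V, E)) \<le> 2 ^ card (verts G)"
      using H by (simp add: three_graph_def card_Pow)
  qed
qed

lemma ex_obstructions_le:
  fixes P :: "'b hgraph"
  assumes P: "three_graph P" "verts P \<noteq> {}"
    and bound: "\<And>y. (\<And>i. y i \<ge> 0) \<Longrightarrow> lagrange_poly P y \<le> c * (\<Sum>i\<in>verts P. y i) ^ 3"
    and c: "c \<ge> 0" and M: "M \<ge> 3 * (card (verts P) + 1)\<^sup>2"
  shows "real (ex n (obstructions P M)) \<le> c * real n ^ 3"
proof (rule ex_le)
  show "c * real n ^ 3 \<ge> 0" using c by simp
  fix G :: "nat hgraph"
  assume G: "three_graph G" "free_of (obstructions P M) G" "card (verts G) = n"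
  have "real (card (edges G)) = lagrange_poly G (\<lambda>_. 1)" by (simp add: lagrange_poly_def)
  also have "\<dots> \<le> c * (\<Sum>v\<in>verts G. 1) ^ 3"
    by (rule lagrange_poly_free_le[OF P bound c M G(1,2)]) auto
  finally show "real (card (edges G)) \<le> c * real n ^ 3" using G(3) by simp
qed

text \<open>
  The sum on the left counts the edges of the blow-up of \<open>P\<close> in which vertex \<open>i\<close> is replaced by
  \<open>a i\<close> copies; projecting copies back to their vertex is a homomorphism. Isolated vertices bring
  the order up to \<open>n\<close>.
\<close>
lemma ex_obstructions_ge:
  fixes P :: "nat hgraph" and a :: "nat \<Rightarrow> nat"
  assumes P: "three_graph P" and n: "(\<Sum>i\<in>verts P. a i) \<le> n"
  shows "(\<Sum>e\<in>edges P. \<Prod>i\<in>e. a i) \<le> ex n (obstructions P M)"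
proof -
  \<comment> \<open>An edge of the blow-up is an edge \<open>f\<close> of \<open>P\<close> with a choice \<open>g\<close> of one copy for each of its
      vertices; copy \<open>k\<close> of vertex \<open>i\<close> is represented by the code of the pair \<open>(i, k)\<close>.\<close>
  let ?D = "SIGMA f:edges P. PiE f (\<lambda>i. {..<a i})"
  define h where "h = (\<lambda>(f :: nat set, g). (\<lambda>i. prod_encode (i, g i)) ` f)"
  let ?V0 = "prod_encode ` (SIGMA i:verts P. {..<a i})"
  have finP: "finite (verts P)" using P by (simp add: three_graph_def)
  have finf: "finite f" if "f \<in> edges P" for f using three_graph_edge[OF P that] by simp
  have finV0: "finite ?V0" using finP by simp
  have "card ?V0 = card (SIGMA i:verts P. {..<a i})"
    by (rule card_image) (simp add: inj_on_def)
  also have "\<dots> = (\<Sum>i\<in>verts P. a i)" using finP by (simp add: card_SigmaI)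
  finally have "card ?V0 \<le> n" using n by simp
  obtain W where W: "finite W" "card W = n - card ?V0" "W \<subseteq> - ?V0"
    using infinite_arbitrarily_large[of "- ?V0" "n - card ?V0"] finV0 by auto
  define V where "V = ?V0 \<union> W"
  have "?V0 \<inter> W = {}" using W(3) by blast
  then have V: "?V0 \<subseteq> V" "finite V" "card V = n"
    unfolding V_def using W finV0 \<open>card ?V0 \<le> n\<close> by (simp_all add: card_Un_disjoint)
  have color: "(fst \<circ> prod_decode) ` h (f, g) = f" for f g
    unfolding h_def by (force simp: image_image)
  have hsub: "h (f, g) \<subseteq> ?V0 \<and> card (h (f, g)) = 3" if "(f, g) \<in> ?D" for f g
  proof -
    have "f \<subseteq> verts P" "card f = 3" using three_graph_edge[OF P] that by auto
    moreover have "card (h (f, g)) = card f"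
      unfolding h_def by (simp add: card_image inj_on_def)
    ultimately show ?thesis using that unfolding h_def by (auto simp: PiE_iff)
  qed
  have inj: "inj_on h ?D"
  proof (rule inj_onI, clarify)
    fix f g f' g'
    assume *: "f \<in> edges P" "f' \<in> edges P" "g \<in> PiE f (\<lambda>i. {..<a i})"
      "g' \<in> PiE f' (\<lambda>i. {..<a i})" and eq: "h (f, g) = h (f', g')"
    have ff: "f = f'" using color[of f g] color[of f' g'] eq by simp
    have "g i = g' i" if "i \<in> f" for i
    proof -
      have "prod_encode (i, g i) \<in> h (f', g')" using that eq unfolding h_def by auto
      then show ?thesis unfolding h_def by auto
    qed
    then show "f = f' \<and> g = g'" using ff * PiE_ext by blast
  qed
  let ?G = "(V, h ` ?D)"
  have tG: "three_graph ?G"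
    using V hsub unfolding three_graph_def by fastforce
  have "colourable P ?G"
    unfolding colourable_def
    by (rule exI[of _ "fst \<circ> prod_decode"]) (auto simp: color simp del: comp_apply o_apply)
  then have "card (edges ?G) \<le> ex (card (verts ?G)) (obstructions P M)"
    by (intro ex_ge tG colourable_free)
  moreover have "card (edges ?G) = (\<Sum>e\<in>edges P. \<Prod>i\<in>e. a i)"
  proof -
    have "card (edges ?G) = card ?D" using inj by (simp add: card_image)
    also have "\<dots> = (\<Sum>e\<in>edges P. card (PiE e (\<lambda>i. {..<a i})))"
      by (rule card_SigmaI) (use three_graph_finite_edges[OF P] finf in \<open>auto intro: finite_PiE\<close>)
    also have "\<dots> = (\<Sum>e\<in>edges P. \<Prod>i\<in>e. a i)"
      by (rule sum.cong) (auto simp: card_PiE finf)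
    finally show ?thesis .
  qed
  ultimately show ?thesis using V(3) by simp
qed

lemma choose_three: "real (n choose 3) = real n * (real n - 1) * (real n - 2) / 6"
proof (induction n)
  case (Suc n)
  have two: "real (n choose 2) = real n * (real n - 1) / 2" for n
    by (induction n) (auto simp: numeral_2_eq_2 field_simps)
  have "Suc n choose 3 = (n choose 2) + (n choose 3)"
    by (simp add: numeral_3_eq_3 numeral_2_eq_2)
  then show ?case using Suc two[of n] by (simp add: field_simps)
qed simp

lemma cube_over_choose_three_tendsto: "(\<lambda>n. real n ^ 3 / real (n choose 3)) \<longlonglongrightarrow> 6"
proof -
  have "(\<lambda>n. 6 / ((1 - 1 / real n) * (1 - 2 / real n))) \<longlonglongrightarrow> 6 / ((1 - 0) * (1 - 0))"
    by (intro tendsto_intros lim_const_over_n) auto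
  then have "(\<lambda>n. 6 / ((1 - 1 / real n) * (1 - 2 / real n))) \<longlonglongrightarrow> 6" by simp
  then show ?thesis
  proof (rule Lim_transform_eventually)
    show "\<forall>\<^sub>F n in sequentially.
        6 / ((1 - 1 / real n) * (1 - 2 / real n)) = real n ^ 3 / real (n choose 3)"
      using eventually_gt_at_top[of 2]
    proof eventually_elim
      case (elim n)
      then have "1 - 1 / real n = (real n - 1) / real n" "1 - 2 / real n = (real n - 2) / real n"
        by (simp_all add: field_simps)
      moreover have "real n \<noteq> 0" "real n - 1 \<noteq> 0" "real n - 2 \<noteq> 0" using elim by auto
      ultimately show ?case
        by (simp only: choose_three) (simp add: divide_simps power3_eq_cube)
    qed
  qed
qed

lemma floor_fraction_tendsto:
  assumes "(x :: real) \<ge> 0"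
  shows "(\<lambda>n. real (nat \<lfloor>x * real n\<rfloor>) / real n) \<longlonglongrightarrow> x"
proof (rule tendsto_sandwich)
  show "(\<lambda>n. x - 1 / real n) \<longlonglongrightarrow> x"
    using tendsto_diff[OF tendsto_const lim_const_over_n[of "1 :: real"]] by simp
  show "(\<lambda>n. x) \<longlonglongrightarrow> x" by simp
  have b: "x * real n - 1 \<le> real (nat \<lfloor>x * real n\<rfloor>)" "real (nat \<lfloor>x * real n\<rfloor>) \<le> x * real n" for n
  proof -
    have "x * real n \<ge> 0" using assms by simp
    then show "x * real n - 1 \<le> real (nat \<lfloor>x * real n\<rfloor>)" "real (nat \<lfloor>x * real n\<rfloor>) \<le> x * real n"
      by linarith+
  qed
  show "\<forall>\<^sub>F n in sequentially. x - 1 / real n \<le> real (nat \<lfloor>x * real n\<rfloor>) / real n"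
    using eventually_gt_at_top[of 0]
  proof eventually_elim
    case (elim n)
    then have "x - 1 / real n = (x * real n - 1) / real n" by (simp add: field_simps)
    also have "\<dots> \<le> real (nat \<lfloor>x * real n\<rfloor>) / real n"
      using b(1) by (rule divide_right_mono) simp
    finally show ?case .
  qed
  show "\<forall>\<^sub>F n in sequentially. real (nat \<lfloor>x * real n\<rfloor>) / real n \<le> x"
    using eventually_gt_at_top[of 0]
    by eventually_elim (use b in \<open>simp add: field_simps\<close>)
qed

text \<open>
  The hypotheses say that \<open>c\<close> is the maximum of the Lagrange polynomial of \<open>P\<close> on the simplex,
  attained at \<open>x\<close>; the factor 6 is the limit of \<open>n ^ 3 / (n choose 3)\<close>. Rounding down the part sizes
  \<open>x i * n\<close> of the blow-up costs nothing in the limit.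
\<close>
theorem lagrangian_density_in_Pi_fin:
  fixes P :: "nat hgraph" and x :: "nat \<Rightarrow> real"
  assumes P: "three_graph P"
    and x: "\<And>i. x i \<ge> 0" "(\<Sum>i\<in>verts P. x i) = 1" "lagrange_poly P x = c"
    and bound: "\<And>y. (\<And>i. y i \<ge> 0) \<Longrightarrow> lagrange_poly P y \<le> c * (\<Sum>i\<in>verts P. y i) ^ 3"
  shows "6 * c \<in> Pi_fin"
proof -
  define M where "M = 3 * (card (verts P) + 1)\<^sup>2"
  let ?F = "obstructions P M"
  have ne: "verts P \<noteq> {}" using x(2) by auto
  have c: "c \<ge> 0" using lagrange_poly_nonneg[of x P] x(1,3) by simp
  define a where "a n i = nat \<lfloor>x i * real n\<rfloor>" for n i
  define r where "r n = real n ^ 3 / real (n choose 3)" for n :: nat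
  have r: "r \<longlonglongrightarrow> 6" unfolding r_def by (rule cube_over_choose_three_tendsto)
  have lower: "(\<Sum>e\<in>edges P. \<Prod>i\<in>e. real (a n i) / real n) * r n \<le> real (ex n ?F) / real (n choose 3)"
    for n
  proof (cases "n = 0")
    case False
    have "real (\<Sum>i\<in>verts P. a n i) \<le> (\<Sum>i\<in>verts P. x i * real n)"
      unfolding of_nat_sum a_def by (rule sum_mono) (use x(1) in \<open>simp add: of_nat_floor\<close>)
    also have "\<dots> = real n" unfolding sum_distrib_right[symmetric] x(2) by simp
    finally have "(\<Sum>i\<in>verts P. a n i) \<le> n" by linarith
    then have "(\<Sum>e\<in>edges P. \<Prod>i\<in>e. a n i) \<le> ex n ?F" by (rule ex_obstructions_ge[OF P])
    then have "real (\<Sum>e\<in>edges P. \<Prod>i\<in>e. a n i) \<le> real (ex n ?F)" by (rule of_nat_mono)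
    then have "(\<Sum>e\<in>edges P. \<Prod>i\<in>e. real (a n i)) \<le> real (ex n ?F)" by simp
    moreover have "(\<Sum>e\<in>edges P. \<Prod>i\<in>e. real (a n i) / real n) * real n ^ 3
        = (\<Sum>e\<in>edges P. \<Prod>i\<in>e. real (a n i))"
      unfolding sum_distrib_right
      by (rule sum.cong) (use False three_graph_edge[OF P] in \<open>auto simp: prod_dividef\<close>)
    ultimately show ?thesis
      unfolding r_def by (simp add: divide_right_mono)
  qed (simp add: r_def)
  have upper: "real (ex n ?F) / real (n choose 3) \<le> c * r n" for n
    using ex_obstructions_le[OF P ne bound c, of M n]
    by (simp add: M_def r_def divide_right_mono)
  have "(\<lambda>n. (\<Sum>e\<in>edges P. \<Prod>i\<in>e. real (a n i) / real n) * r n)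
      \<longlonglongrightarrow> (\<Sum>e\<in>edges P. \<Prod>i\<in>e. x i) * 6"
    unfolding a_def by (intro tendsto_intros floor_fraction_tendsto x r)
  then have lo: "(\<lambda>n. (\<Sum>e\<in>edges P. \<Prod>i\<in>e. real (a n i) / real n) * r n) \<longlonglongrightarrow> 6 * c"
    using x(3) by (simp add: lagrange_poly_def mult.commute)
  have hi: "(\<lambda>n. c * r n) \<longlonglongrightarrow> 6 * c"
    using tendsto_mult_left[OF r, of c] by (simp add: mult.commute)
  have "(\<lambda>n. real (ex n ?F) / real (n choose 3)) \<longlonglongrightarrow> 6 * c"
    by (rule tendsto_sandwich[OF _ _ lo hi]) (use lower upper in auto)
  then have "turan_density ?F = 6 * c"
    unfolding turan_density_def by (rule limI)
  then show ?thesis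
    unfolding Pi_fin_def using finite_obstructions[of P M]
    by (force simp: obstructions_def)
qed


section \<open>Inequalities between means\<close>

lemma mult_le_square_sum: "x * y \<le> (x + y)\<^sup>2 / 4" for x y :: real
proof -
  have "(x + y)\<^sup>2 / 4 - x * y = (x - y)\<^sup>2 / 4" by (simp add: field_simps power2_eq_square)
  then show ?thesis using zero_le_power2[of "x - y"] by linarith
qed

lemma pairs3_le_square_sum: "x * y + x * z + y * z \<le> (x + y + z)\<^sup>2 / 3" for x y z :: real
proof -
  have "(x + y + z)\<^sup>2 / 3 - (x * y + x * z + y * z) = ((x - y)\<^sup>2 + (x - z)\<^sup>2 + (y - z)\<^sup>2) / 6"
    by (simp add: field_simps power2_eq_square)
  moreover have "\<dots> \<ge> 0" by simp
  ultimately show ?thesis by linarith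
qed

lemma mult3_le_cube_sum:
  fixes x y z :: real
  assumes "x \<ge> 0" "y \<ge> 0" "z \<ge> 0"
  shows "x * y * z \<le> (x + y + z) ^ 3 / 27"
proof -
  have "(x + y + z) ^ 3 / 27 - x * y * z =
    (x * (y - z)\<^sup>2 + y * (x - z)\<^sup>2 + z * (x - y)\<^sup>2) / 9
    + (x + y + z) * ((x - y)\<^sup>2 + (x - z)\<^sup>2 + (y - z)\<^sup>2) / 54"
    by (simp add: field_simps power2_eq_square power3_eq_cube)
  moreover have "\<dots> \<ge> 0"
    using assms by (intro add_nonneg_nonneg divide_nonneg_nonneg mult_nonneg_nonneg) auto
  ultimately show ?thesis by linarith
qed

text \<open>
  The inequality between arithmetic and geometric mean for \<open>x\<close>, \<open>s / 2\<close>, \<open>s / 2\<close>.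
\<close>
lemma mult_square_le_cube:
  fixes x s :: real
  assumes "x \<ge> 0" "s \<ge> 0"
  shows "x * s\<^sup>2 \<le> 4 / 27 * (x + s) ^ 3"
proof -
  have "4 / 27 * (x + s) ^ 3 - x * s\<^sup>2 = (s - 2 * x)\<^sup>2 * (4 * s + x) / 27"
    by (simp add: field_simps power2_eq_square power3_eq_cube)
  moreover have "\<dots> \<ge> 0" using assms by simp
  ultimately show ?thesis by linarith
qed

section \<open>Seven 3-graphs and their Lagrange polynomials\<close>

text \<open>
  A cone over a triangle: with the weight of the apex 0 fixed, equal weights are best for the
  three other vertices, and the balance between them and the apex is then a problem in one variable.
\<close>
lemma eight_twentysevenths_in_Pi_fin: "8 / 27 \<in> Pi_fin"
proof -
  let ?P = "({0, 1, 2, 3}, {{0, 1, 2}, {0, 1, 3}, {0, 2, 3}}) :: nat hgraph"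
  have L: "lagrange_poly ?P y = y 0 * (y 1 * y 2 + y 1 * y 3 + y 2 * y 3)" for y
    by (simp add: lagrange_poly_def set_eq_subset algebra_simps)
  have "6 * (4 / 81) \<in> Pi_fin"
  proof (rule lagrangian_density_in_Pi_fin[of ?P "\<lambda>i. if i = 0 then 1 / 3 else 2 / 9"])
    show "three_graph ?P" by (auto simp: three_graph_def)
    fix y :: "nat \<Rightarrow> real" assume y: "\<And>i. y i \<ge> 0"
    let ?s = "y 1 + y 2 + y 3"
    have "lagrange_poly ?P y \<le> y 0 * (?s\<^sup>2 / 3)"
      unfolding L by (intro mult_left_mono pairs3_le_square_sum y)
    also have "\<dots> \<le> 4 / 81 * (y 0 + ?s) ^ 3"
      using mult_square_le_cube[of "y 0" ?s] y by simp
    finally show "lagrange_poly ?P y \<le> 4 / 81 * (\<Sum>i\<in>verts ?P. y i) ^ 3"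
      by (simp add: add_ac)
  qed (simp_all add: L del: One_nat_def)
  then show ?thesis by simp
qed

text \<open>
  A cone over the complete graph on four vertices: all triples through vertex 0. Equal weights
  are best for the four other vertices; if \<open>s\<close> is their total, their pairs contribute
  \<open>3 / 8 * s\<^sup>2\<close>, and only the balance between \<open>s\<close> and the weight of 0 remains.
\<close>
lemma one_third_in_Pi_fin: "1 / 3 \<in> Pi_fin"
proof -
  let ?P = "({0, 1, 2, 3, 4},
    {{0, 1, 2}, {0, 1, 3}, {0, 1, 4}, {0, 2, 3}, {0, 2, 4}, {0, 3, 4}}) :: nat hgraph"
  have L: "lagrange_poly ?P y
      = y 0 * (y 1 * y 2 + y 1 * y 3 + y 1 * y 4 + y 2 * y 3 + y 2 * y 4 + y 3 * y 4)" for y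
    by (simp add: lagrange_poly_def set_eq_subset algebra_simps)
  have "6 * (1 / 18) \<in> Pi_fin"
  proof (rule lagrangian_density_in_Pi_fin[of ?P "\<lambda>i. if i = 0 then 1 / 3 else 1 / 6"])
    show "three_graph ?P" by (auto simp: three_graph_def)
    fix y :: "nat \<Rightarrow> real" assume y: "\<And>i. y i \<ge> 0"
    let ?a = "y 1 + y 2" and ?b = "y 3 + y 4"
    have "lagrange_poly ?P y = y 0 * (y 1 * y 2 + y 3 * y 4 + ?a * ?b)"
      unfolding L by (simp add: algebra_simps)
    also have "\<dots> \<le> y 0 * (?a\<^sup>2 / 4 + ?b\<^sup>2 / 4 + ?a * ?b)"
      by (intro mult_left_mono add_mono mult_le_square_sum y order_refl)
    also have "\<dots> \<le> y 0 * (3 / 8 * (?a + ?b)\<^sup>2)"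
    proof -
      have "a\<^sup>2 / 4 + b\<^sup>2 / 4 + a * b = (a + b)\<^sup>2 / 4 + a * b / 2" for a b :: real
        by (simp add: field_simps power2_eq_square)
      then show ?thesis
        using mult_le_square_sum[of ?a ?b] y by (intro mult_left_mono) simp_all
    qed
    also have "\<dots> \<le> 1 / 18 * (y 0 + (?a + ?b)) ^ 3"
      using mult_square_le_cube[of "y 0" "?a + ?b"] y by simp
    finally show "lagrange_poly ?P y \<le> 1 / 18 * (\<Sum>i\<in>verts ?P. y i) ^ 3"
      by (simp add: add_ac)
  qed (simp_all add: L del: One_nat_def)
  then show ?thesis by simp
qed

text \<open>
  The complete 3-graph on five vertices without the edges \<open>{0, 1, 4}\<close> and \<open>{2, 3, 4}\<close>. The polynomial
  depends on the pairs \<open>0, 1\<close> and \<open>2, 3\<close> symmetrically, so equalizing inside and then between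
  the pairs leaves one variable.
\<close>
lemma thirtytwo_eightyfirsts_in_Pi_fin: "32 / 81 \<in> Pi_fin"
proof -
  let ?P = "({0, 1, 2, 3, 4},
    {{0, 1, 2}, {0, 1, 3}, {0, 2, 3}, {1, 2, 3}, {0, 2, 4}, {0, 3, 4}, {1, 2, 4}, {1, 3, 4}}) :: nat hgraph"
  have L: "lagrange_poly ?P y = y 0 * y 1 * (y 2 + y 3) + y 2 * y 3 * (y 0 + y 1)
      + y 4 * (y 0 + y 1) * (y 2 + y 3)" for y
    by (simp add: lagrange_poly_def set_eq_subset algebra_simps)
  have "6 * (16 / 243) \<in> Pi_fin"
  proof (rule lagrangian_density_in_Pi_fin[of ?P "\<lambda>i. if i = 4 then 1 / 9 else 2 / 9"])
    show "three_graph ?P" by (auto simp: three_graph_def)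
    fix y :: "nat \<Rightarrow> real" assume y: "\<And>i. y i \<ge> 0"
    let ?a = "y 0 + y 1" and ?b = "y 2 + y 3" and ?c = "y 4"
    let ?s = "?a + ?b"
    have s: "?s \<ge> 0" using y by (simp add: add_nonneg_nonneg)
    have "lagrange_poly ?P y \<le> ?a\<^sup>2 / 4 * ?b + ?b\<^sup>2 / 4 * ?a + ?c * ?a * ?b"
      unfolding L by (intro mult_right_mono add_mono mult_le_square_sum y order_refl add_nonneg_nonneg)
    also have "\<dots> = ?a * ?b * (?s / 4 + ?c)" by (simp add: field_simps power2_eq_square)
    also have "\<dots> \<le> ?s\<^sup>2 / 4 * (?s / 4 + ?c)"
      by (intro mult_right_mono mult_le_square_sum add_nonneg_nonneg y s) (use s in simp)
    also have "\<dots> \<le> 16 / 243 * (?s + ?c) ^ 3"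
    proof -
      have "16 / 243 * (s + c) ^ 3 - s\<^sup>2 / 4 * (s / 4 + c) = (s - 8 * c)\<^sup>2 * (13 * s + 4 * c) / 3888"
        for s c :: real by (simp add: field_simps power2_eq_square power3_eq_cube)
      moreover have "(?s - 8 * ?c)\<^sup>2 * (13 * ?s + 4 * ?c) / 3888 \<ge> 0"
        using s y by (intro divide_nonneg_nonneg mult_nonneg_nonneg add_nonneg_nonneg) auto
      ultimately show ?thesis by (smt (verit))
    qed
    finally show "lagrange_poly ?P y \<le> 16 / 243 * (\<Sum>i\<in>verts ?P. y i) ^ 3"
      by (simp add: add_ac)
  qed (simp_all add: L del: One_nat_def)
  then show ?thesis by simp
qed

text \<open>
  The complete 3-graph on five vertices without the edge \<open>{0, 1, 2}\<close>. Equalizing the weights of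
  \<open>0, 1, 2\<close>, of total \<open>a\<close>, and of \<open>3, 4\<close>, of total \<open>b\<close>, leaves a binary cubic form. It is
  largest, relative to \<open>(a + b) ^ 3\<close>, at the ratio \<open>a / b = (sqrt 13 + 1) / 4\<close>, a root of a quadratic
  equation; this ratio is a double root of the difference to the bound.
\<close>
lemma sqrt_13_density_in_Pi_fin: "(13 * sqrt 13 - 35) / 27 \<in> Pi_fin"
proof -
  let ?P = "({0, 1, 2, 3, 4}, {{0, 1, 3}, {0, 2, 3}, {1, 2, 3}, {0, 1, 4}, {0, 2, 4}, {1, 2, 4},
    {0, 3, 4}, {1, 3, 4}, {2, 3, 4}}) :: nat hgraph"
  have L: "lagrange_poly ?P y = (y 0 * y 1 + y 0 * y 2 + y 1 * y 2) * (y 3 + y 4)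
      + (y 0 + y 1 + y 2) * (y 3 * y 4)" for y
    by (simp add: lagrange_poly_def set_eq_subset algebra_simps)
  define r where "r = sqrt 13"
  define c where "c = (13 * r - 35) / 162"
  have r2: "r * r = 13" by (simp add: r_def)
  have r: "35 / 13 \<le> r" "r \<le> 5"
    unfolding r_def by (rule real_le_rsqrt real_le_lsqrt; simp add: power2_eq_square)+
  have c0: "c \<ge> 0" using r by (simp add: c_def)
  have "6 * c \<in> Pi_fin"
  proof (rule lagrangian_density_in_Pi_fin[of ?P "\<lambda>i. if i < 3 then (r - 2) / 9 else (5 - r) / 6"])
    show "three_graph ?P" by (auto simp: three_graph_def)
    show "0 \<le> (if i < 3 then (r - 2) / 9 else (5 - r) / 6)" for i :: nat using r by simp
    show "(\<Sum>i\<in>verts ?P. if i < 3 then (r - 2) / 9 else (5 - r) / 6) = 1" by (simp add: field_simps)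
    show "lagrange_poly ?P (\<lambda>i. if i < 3 then (r - 2) / 9 else (5 - r) / 6) = c"
    proof -
      have rr: "r * (r * k) = 13 * k" for k using r2 by (simp flip: mult.assoc)
      show ?thesis unfolding L c_def by (simp add: field_simps r2 rr)
    qed
    fix y :: "nat \<Rightarrow> real" assume y: "\<And>i. y i \<ge> 0"
    let ?a = "y 0 + y 1 + y 2" and ?b = "y 3 + y 4"
    have a0: "?a \<ge> 0" and b0: "?b \<ge> 0" using y by (simp_all add: add_nonneg_nonneg)
    have "lagrange_poly ?P y \<le> ?a\<^sup>2 / 3 * ?b + ?a * (?b\<^sup>2 / 4)"
      unfolding L by (intro mult_right_mono mult_left_mono add_mono mult_le_square_sum
          pairs3_le_square_sum a0 b0)
    also have "\<dots> \<le> c * (?a + ?b) ^ 3"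
    proof -
      \<comment> \<open>The double root fixes the square; comparing the coefficients of \<open>b ^ 3\<close> gives the linear factor.\<close>
      have "c * (a + b) ^ 3 - (a\<^sup>2 / 3 * b + a * (b\<^sup>2 / 4))
        = c * (a - (r + 1) / 4 * b)\<^sup>2 * (a + 2 * (7 - r) / 9 * b)" for a b
      proof -
        define q s where "q = (r + 1) / 4" and "s = 2 * (7 - r) / 9"
        have rr: "r * (r * k) = 13 * k" for k using r2 by (simp flip: mult.assoc)
        have coeffs: "c * (q\<^sup>2 * s) = c" "c * (s - 2 * q) = 3 * c - 1 / 3"
          "c * (q\<^sup>2 - 2 * q * s) = 3 * c - 1 / 4"
          unfolding q_def s_def c_def by (simp_all add: field_simps power2_eq_square r2 rr)
        have "c * (a - q * b)\<^sup>2 * (a + s * b) = c * a ^ 3 + c * (s - 2 * q) * (a\<^sup>2 * b)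
            + c * (q\<^sup>2 - 2 * q * s) * (a * b\<^sup>2) + c * (q\<^sup>2 * s) * b ^ 3"
          by (simp add: algebra_simps power2_eq_square power3_eq_cube)
        also have "\<dots> = c * (a + b) ^ 3 - (a\<^sup>2 / 3 * b + a * (b\<^sup>2 / 4))"
          unfolding coeffs by (simp add: field_simps power2_eq_square power3_eq_cube)
        finally show ?thesis by (simp add: q_def s_def)
      qed
      moreover have "c * (?a - (r + 1) / 4 * ?b)\<^sup>2 * (?a + 2 * (7 - r) / 9 * ?b) \<ge> 0"
        using c0 r y by (intro mult_nonneg_nonneg add_nonneg_nonneg) auto
      ultimately show ?thesis by (smt (verit))
    qed
    finally show "lagrange_poly ?P y \<le> c * (\<Sum>i\<in>verts ?P. y i) ^ 3"
      by (simp add: add_ac)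
  qed
  moreover have "6 * c = (13 * sqrt 13 - 35) / 27" by (simp add: c_def r_def)
  ultimately show ?thesis by (simp only:)
qed

text \<open>
  The three edges through the pair \<open>3, 4\<close>, and the edge \<open>{0, 1, 2}\<close>. With weights \<open>s\<close> of
  \<open>{0, 1, 2}\<close> and \<open>p\<close> of \<open>{3, 4}\<close>, the critical ratio is \<open>p / s = 1 + sqrt 5 / 3\<close>.
\<close>
lemma sqrt_5_density_in_Pi_fin: "(189 + 15 * sqrt 5) / 961 \<in> Pi_fin"
proof -
  let ?P = "({0, 1, 2, 3, 4}, {{0, 1, 2}, {0, 3, 4}, {1, 3, 4}, {2, 3, 4}}) :: nat hgraph"
  have L: "lagrange_poly ?P y = y 0 * y 1 * y 2 + (y 3 * y 4) * (y 0 + y 1 + y 2)" for y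
    by (simp add: lagrange_poly_def set_eq_subset algebra_simps)
  define r where "r = sqrt 5"
  define c where "c = (63 + 5 * r) / 1922"
  have r2: "r * r = 5" by (simp add: r_def)
  have r: "893 / 402 \<le> r" "r \<le> 6"
    unfolding r_def by (rule real_le_rsqrt real_le_lsqrt; simp add: power2_eq_square)+
  have c0: "c \<ge> 0" using r by (simp add: c_def)
  have "6 * c \<in> Pi_fin"
  proof (rule lagrangian_density_in_Pi_fin[of ?P "\<lambda>i. if i < 3 then (6 - r) / 31 else (13 + 3 * r) / 62"])
    show "three_graph ?P" by (auto simp: three_graph_def)
    show "0 \<le> (if i < 3 then (6 - r) / 31 else (13 + 3 * r) / 62)" for i :: nat using r by simp
    show "(\<Sum>i\<in>verts ?P. if i < 3 then (6 - r) / 31 else (13 + 3 * r) / 62) = 1" by (simp add: field_simps)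
    show "lagrange_poly ?P (\<lambda>i. if i < 3 then (6 - r) / 31 else (13 + 3 * r) / 62) = c"
    proof -
      have rr: "r * (r * k) = 5 * k" for k using r2 by (simp flip: mult.assoc)
      show ?thesis unfolding L c_def by (simp add: field_simps r2 rr)
    qed
    fix y :: "nat \<Rightarrow> real" assume y: "\<And>i. y i \<ge> 0"
    let ?s = "y 0 + y 1 + y 2" and ?p = "y 3 + y 4"
    have s0: "?s \<ge> 0" using y by (simp_all add: add_nonneg_nonneg)
    have "lagrange_poly ?P y \<le> ?s ^ 3 / 27 + ?p\<^sup>2 / 4 * ?s"
      unfolding L by (intro mult_right_mono add_mono mult_le_square_sum mult3_le_cube_sum s0 y)
    also have "\<dots> \<le> c * (?s + ?p) ^ 3"
    proof -
      \<comment> \<open>The square comes from the critical ratio, the linear factor from the coefficients of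
          \<open>p ^ 3\<close> and \<open>s ^ 3\<close>. Its coefficient of \<open>s\<close> is positive by a small
          margin, which is why the lower bound on \<open>r\<close> is so close to \<open>sqrt 5\<close>.\<close>
      have "c * (s + p) ^ 3 - (s ^ 3 / 27 + p\<^sup>2 / 4 * s)
        = (p - (3 + r) / 3 * s)\<^sup>2 * (c * p + (402 * r - 893) / 11532 * s)" for s p
      proof -
        define q t where "q = (3 + r) / 3" and "t = (402 * r - 893) / 11532"
        have rr: "r * (r * k) = 5 * k" for k using r2 by (simp flip: mult.assoc)
        have coeffs: "q\<^sup>2 * t = c - 1 / 27" "q\<^sup>2 * c - 2 * q * t = 3 * c" "t - 2 * q * c = 3 * c - 1 / 4"
          unfolding q_def t_def c_def by (simp_all add: field_simps power2_eq_square r2 rr)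
        have "(p - q * s)\<^sup>2 * (c * p + t * s) = q\<^sup>2 * t * s ^ 3 + (q\<^sup>2 * c - 2 * q * t) * (s\<^sup>2 * p)
            + (t - 2 * q * c) * (s * p\<^sup>2) + c * p ^ 3"
          by (simp add: algebra_simps power2_eq_square power3_eq_cube)
        also have "\<dots> = c * (s + p) ^ 3 - (s ^ 3 / 27 + p\<^sup>2 / 4 * s)"
          unfolding coeffs by (simp add: field_simps power2_eq_square power3_eq_cube)
        finally show ?thesis by (simp add: q_def t_def)
      qed
      moreover have "(?p - (3 + r) / 3 * ?s)\<^sup>2 * (c * ?p + (402 * r - 893) / 11532 * ?s) \<ge> 0"
        using c0 r y by (intro mult_nonneg_nonneg add_nonneg_nonneg) auto
      ultimately show ?thesis by (smt (verit))
    qed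
    finally show "lagrange_poly ?P y \<le> c * (\<Sum>i\<in>verts ?P. y i) ^ 3"
      by (simp add: add_ac)
  qed
  moreover have "6 * c = (189 + 15 * sqrt 5) / 961" by (simp add: c_def r_def)
  ultimately show ?thesis by (simp only:)
qed

text \<open>
  Cyclic symmetry permits \<open>a\<close> to be the smallest variable. Then the sum can be regrouped into two
  products with nonnegative factors, and the mean inequalities for both are sharp at the same
  point, where all variables are equal.
\<close>
lemma cyclic_triples_le:
  fixes a b c d e :: real
  assumes "0 \<le> a" "a \<le> b" "a \<le> c" "a \<le> d" "a \<le> e"
  shows "a * b * c + b * c * d + c * d * e + d * e * a + e * a * b \<le> (a + b + c + d + e) ^ 3 / 25"
proof -
  let ?q = "b + c + d + e"
  have "a * b * c + b * c * d + c * d * e + d * e * a + e * a * b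
      = a * ((c + e) * (b + d)) + c * d * (b + e - a)"
    by (simp add: algebra_simps)
  also have "\<dots> \<le> a * ((c + e + (b + d))\<^sup>2 / 4) + (c + d + (b + e - a)) ^ 3 / 27"
    using assms by (intro add_mono mult_left_mono mult_le_square_sum mult3_le_cube_sum) auto
  also have "\<dots> = a * (?q\<^sup>2 / 4) + (?q - a) ^ 3 / 27"
    by (simp add: algebra_simps)
  also have "\<dots> \<le> (a + ?q) ^ 3 / 25"
  proof -
    have "(a + q) ^ 3 / 25 - (a * (q\<^sup>2 / 4) + (q - a) ^ 3 / 27) = (q - 4 * a)\<^sup>2 * (8 * q + 13 * a) / 2700"
      for q :: real by (simp add: field_simps power2_eq_square power3_eq_cube)
    moreover have "(?q - 4 * a)\<^sup>2 * (8 * ?q + 13 * a) / 2700 \<ge> 0" using assms by simp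
    ultimately show ?thesis by (smt (verit))
  qed
  finally show ?thesis by (simp add: add_ac)
qed

text \<open>
  For the tight cycle on five vertices, where uniform weights are optimal, a rotation
  makes the smallest weight the first one.
\<close>
lemma six_twentyfifths_in_Pi_fin: "6 / 25 \<in> Pi_fin"
proof -
  let ?P = "({0, 1, 2, 3, 4}, {{0, 1, 2}, {1, 2, 3}, {2, 3, 4}, {3, 4, 0}, {4, 0, 1}}) :: nat hgraph"
  have L: "lagrange_poly ?P y = y 0 * y 1 * y 2 + y 1 * y 2 * y 3 + y 2 * y 3 * y 4
      + y 3 * y 4 * y 0 + y 4 * y 0 * y 1" for y
    by (simp add: lagrange_poly_def set_eq_subset algebra_simps)
  have "6 * (1 / 25) \<in> Pi_fin"
  proof (rule lagrangian_density_in_Pi_fin[of ?P "\<lambda>i. 1 / 5"])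
    show "three_graph ?P" by (auto simp: three_graph_def)
    fix y :: "nat \<Rightarrow> real" assume y: "\<And>i. y i \<ge> 0"
    let ?min = "\<lambda>i. \<forall>j\<in>{0, 1, 2, 3, 4}. y i \<le> y j"
    have "\<exists>i\<in>{0, 1, 2, 3, 4}. ?min i"
      using arg_min_if_finite(1)[of "{0, 1, 2, 3, 4}" y] arg_min_least[of "{0, 1, 2, 3, 4}" _ y] by blast
    then consider "?min 0" | "?min 1" | "?min 2" | "?min 3" | "?min 4" by blast
    then have "lagrange_poly ?P y \<le> (y 0 + y 1 + y 2 + y 3 + y 4) ^ 3 / 25"
    proof cases
      case 1 then show ?thesis
        using cyclic_triples_le[of "y 0" "y 1" "y 2" "y 3" "y 4"] y
        unfolding L by (simp add: ac_simps)
    next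
      case 2 then show ?thesis
        using cyclic_triples_le[of "y 1" "y 2" "y 3" "y 4" "y 0"] y
        unfolding L by (simp add: ac_simps)
    next
      case 3 then show ?thesis
        using cyclic_triples_le[of "y 2" "y 3" "y 4" "y 0" "y 1"] y
        unfolding L by (simp add: ac_simps)
    next
      case 4 then show ?thesis
        using cyclic_triples_le[of "y 3" "y 4" "y 0" "y 1" "y 2"] y
        unfolding L by (simp add: ac_simps)
    next
      case 5 then show ?thesis
        using cyclic_triples_le[of "y 4" "y 0" "y 1" "y 2" "y 3"] y
        unfolding L by (simp add: ac_simps)
    qed
    then show "lagrange_poly ?P y \<le> 1 / 25 * (\<Sum>i\<in>verts ?P. y i) ^ 3" by (simp add: add_ac)
  qed (simp_all add: L del: One_nat_def)
  then show ?thesis by simp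
qed

text \<open>
  For fixed \<open>s = a + b\<close> and \<open>t\<close> the left side is concave in \<open>b\<close>, with vertex at
  \<open>b = 2 / 3 * (s - t / 3)\<close>. If \<open>t \<le> 3 * s\<close>, completing the square there suffices. For larger \<open>t\<close> the
  vertex is negative and the comparison is with the boundary value \<open>b = 0\<close>.
\<close>
lemma mult_quadratic_le_cube:
  fixes a b t :: real
  assumes "a \<ge> 0" "b \<ge> 0" "t \<ge> 0"
  shows "t * (a * b + b\<^sup>2 / 4 + a * t / 3 + t\<^sup>2 / 27) \<le> 7 / 108 * (a + b + t) ^ 3"
proof (cases "t \<le> 3 * (a + b)")
  case True
  have "7 / 108 * (a + b + t) ^ 3 - t * (a * b + b\<^sup>2 / 4 + a * t / 3 + t\<^sup>2 / 27)
      = (a + b - t)\<^sup>2 * (7 * (a + b) - t) / 108 + t * (3 / 4 * (b - 2 / 3 * (a + b - t / 3))\<^sup>2)"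
    by (simp add: field_simps power2_eq_square power3_eq_cube)
  moreover have "\<dots> \<ge> 0" using True assms by simp
  ultimately show ?thesis by linarith
next
  case False
  let ?s = "a + b"
  have "7 / 108 * (a + b + t) ^ 3 - t * (a * b + b\<^sup>2 / 4 + a * t / 3 + t\<^sup>2 / 27)
      = (7 * ?s ^ 3 + t * (3 * (t - 5 / 2 * ?s)\<^sup>2 + 9 / 4 * ?s\<^sup>2)) / 108 + t * (b * (3 / 4 * b + t / 3 - ?s))"
    by (simp add: field_simps power2_eq_square power3_eq_cube)
  moreover have "\<dots> \<ge> 0"
    using False assms by (intro add_nonneg_nonneg divide_nonneg_nonneg mult_nonneg_nonneg) auto
  ultimately show ?thesis by linarith
qed

text \<open>
  All triples that meet \<open>{0, 1, 2}\<close> in exactly two vertices, the triples through 0 with two vertices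
  in \<open>{3, 4, 5}\<close>, and \<open>{3, 4, 5}\<close> itself. The remaining variables \<open>a\<close>, \<open>b\<close>, \<open>t\<close> are the weight of 0 and the
  total weights of \<open>{1, 2}\<close> and \<open>{3, 4, 5}\<close>.
\<close>
lemma seven_eighteenths_in_Pi_fin: "7 / 18 \<in> Pi_fin"
proof -
  let ?P = "({0, 1, 2, 3, 4, 5}, {{0, 1, 3}, {0, 1, 4}, {0, 1, 5}, {0, 2, 3}, {0, 2, 4}, {0, 2, 5},
    {1, 2, 3}, {1, 2, 4}, {1, 2, 5}, {0, 3, 4}, {0, 3, 5}, {0, 4, 5}, {3, 4, 5}}) :: nat hgraph"
  have L: "lagrange_poly ?P y = (y 3 + y 4 + y 5) * (y 0 * (y 1 + y 2) + y 1 * y 2)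
      + y 0 * (y 3 * y 4 + y 3 * y 5 + y 4 * y 5) + y 3 * y 4 * y 5" for y
    by (simp add: lagrange_poly_def set_eq_subset algebra_simps)
  have "6 * (7 / 108) \<in> Pi_fin"
  proof (rule lagrangian_density_in_Pi_fin[of ?P
      "\<lambda>i. if i = 0 then 5 / 18 else if i < 3 then 1 / 9 else 1 / 6"])
    show "three_graph ?P" by (auto simp: three_graph_def)
    fix y :: "nat \<Rightarrow> real" assume y: "\<And>i. y i \<ge> 0"
    let ?a = "y 0" and ?b = "y 1 + y 2" and ?t = "y 3 + y 4 + y 5"
    have b0: "?b \<ge> 0" and t0: "?t \<ge> 0" using y by (simp_all add: add_nonneg_nonneg)
    have "lagrange_poly ?P y \<le> ?t * (?a * ?b + ?b\<^sup>2 / 4) + ?a * (?t\<^sup>2 / 3) + ?t ^ 3 / 27"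
      unfolding L by (intro add_mono mult_left_mono order_refl mult_le_square_sum
          pairs3_le_square_sum mult3_le_cube_sum y t0)
    also have "\<dots> = ?t * (?a * ?b + ?b\<^sup>2 / 4 + ?a * ?t / 3 + ?t\<^sup>2 / 27)"
      by (simp add: algebra_simps power2_eq_square power3_eq_cube)
    also have "\<dots> \<le> 7 / 108 * (?a + ?b + ?t) ^ 3"
      by (rule mult_quadratic_le_cube[OF y b0 t0])
    finally show "lagrange_poly ?P y \<le> 7 / 108 * (\<Sum>i\<in>verts ?P. y i) ^ 3"
      by (simp add: add_ac)
  qed (simp_all add: L del: One_nat_def)
  then show ?thesis by simp
qed

theorem corollary23:
  "{(189 + 15 * sqrt 5) / 961, 6 / 25, 8 / 27, 1 / 3, 7 / 18, 32 / 81,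
    (13 * sqrt 13 - 35) / 27} \<subseteq> Pi_fin"
  using sqrt_5_density_in_Pi_fin six_twentyfifths_in_Pi_fin eight_twentysevenths_in_Pi_fin
    one_third_in_Pi_fin seven_eighteenths_in_Pi_fin thirtytwo_eightyfirsts_in_Pi_fin
    sqrt_13_density_in_Pi_fin
  by simp

end
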